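(* Let $R$ be a unital $*$-ring and let $a\in R$ be regular with an inner inverse $a^{-}$. Then the following conditions are equivalent: (i) $a$ is Moore-Penrose invertible. (ii) $aa^*+1-aa^{-}$ is right invertible. (iii) $a^*a+1-a^{-}a$ is right invertible. (iv) $aa^*aa^{-}+1-aa^{-}$ is right invertible. (v) $a^{-}aa^*a+1-a^{-}a$ is right invertible. (vi) $aa^*+1-aa^{-}$ is left invertible. (vii) $a^*a+1-a^{-}a$ is left invertible. (viii) $aa^*aa^{-}+1-aa^{-}$ is left invertible. (ix) $a^{-}aa^*a+1-a^{-}a$ is left invertible.
   Context: A unital $*$-ring is an associative (not necessarily commutative) ring $R$ with unity $1$ and an involution $a\mapsto a^*$ satisfying $(a^* )^*=a$, $(a+b)^*=a^*+b^*$, $(ab)^*=b^*a^*$ for all $a,b\in R$. An element $a\in R$ is regular if there is $x\in R$ with $axa=a$; such an $x$ is called an inner inverse of $a$. An element $a\in R$ is Moore-Penrose invertible if there is $x\in R$ with $axa=a$, $xax=x$, $(ax)^*=ax$ and $(xa)^*=xa$. *)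

theory Defs
  imports Main
begin

text \<open>
  The base is \<open>ring + monoid_mult\<close> rather than \<open>ring_1\<close>: the latter
  additionally requires 0 and 1 to be distinct, which is not part of the notion of a unital ring.
\<close>

class star_ring = ring + monoid_mult +
  fixes star :: "'a \<Rightarrow> 'a"
  assumes star_star: "star (star a) = a"
    and star_add: "star (a + b) = star a + star b"
    and star_mult: "star (a * b) = star b * star a"

definition is_inner_inverse :: "'a::semigroup_mult \<Rightarrow> 'a \<Rightarrow> bool" where
  "is_inner_inverse a x \<longleftrightarrow> a * x * a = a"

definition regular_element :: "'a::semigroup_mult \<Rightarrow> bool" where
  "regular_element a \<longleftrightarrow> (\<exists>x. is_inner_inverse a x)"

definition moore_penrose_invertible :: "'a::star_ring \<Rightarrow> bool" where
  "moore_penrose_invertible a \<longleftrightarrow>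
     (\<exists>x. a * x * a = a \<and> x * a * x = x \<and> star (a * x) = a * x \<and> star (x * a) = x * a)"

definition right_invertible :: "'a::monoid_mult \<Rightarrow> bool" where
  "right_invertible b \<longleftrightarrow> (\<exists>x. b * x = 1)"

definition left_invertible :: "'a::monoid_mult \<Rightarrow> bool" where
  "left_invertible b \<longleftrightarrow> (\<exists>x. x * b = 1)"

end

theory Submission
  imports Defs
begin

text \<open>
  The proof rests on one criterion: \<open>a\<close> is Moore-Penrose invertible iff \<open>a \<in> a a* a R\<close>
  (lemma \<open>moore_penrose_iff_right_factor\<close>). Only one side is required because \<open>s = a* a\<close> is
  self-adjoint, so that \<open>s = s s y\<close> yields \<open>s = y* s s\<close> as well.

  Given an inner inverse \<open>a'\<close>, the corner element \<open>a' a a* a + 1 - a' a\<close> turns the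
  criterion into an invertibility statement: multiplied by \<open>a\<close> on the left it becomes \<open>a a* a\<close>,
  so a right inverse of it is a solution \<open>y\<close> of \<open>a = a a* a y\<close>; conversely the compression of
  a solution to the corner of the idempotent \<open>a' a\<close>, completed by \<open>1 - a' a\<close>, is a right
  inverse.

  The other three elements are reached by Jacobson's lemma, that \<open>1 + x y\<close> and \<open>1 + y x\<close>
  are right invertible together, because with \<open>e = a a'\<close>
  \<^item> \<open>a a* + 1 - e = 1 + a (a* - a')\<close> and \<open>a* a + 1 - a' a = 1 + (a* - a') a\<close>;
  \<^item> \<open>a a* + 1 - e = 1 + e (a a* - 1)\<close> and \<open>a a* a a' + 1 - e = 1 + (a a* - 1) e\<close>;
  \<^item> \<open>a a* a a' + 1 - e = 1 + (a a* a - a) a'\<close> and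
    \<open>a' a a* a + 1 - a' a = 1 + a' (a a* a - a)\<close>.

  Left invertibility needs no second argument: the involution exchanges left and right, and the
  adjoints of the four elements are the four elements formed from \<open>a*\<close> and its inner inverse
  \<open>a'*\<close>, while \<open>a\<close> and \<open>a*\<close> are Moore-Penrose invertible together.
\<close>

section \<open>The involution\<close>

lemma star_one: "star (1::'a::star_ring) = 1"
  by (metis star_star star_mult mult_1_left mult_1_right)

lemma star_diff: "star (x - y) = star x - star (y::'a::star_ring)"
  by (metis star_add diff_add_cancel add_diff_cancel_right')

lemma left_invertible_iff_star:
  fixes b :: "'a::star_ring"
  shows "left_invertible b \<longleftrightarrow> right_invertible (star b)"
  unfolding left_invertible_def right_invertible_def
  by (metis star_star star_mult star_one)

lemma is_inner_inverse_star:
  fixes a x :: "'a::star_ring"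
  shows "is_inner_inverse a x \<Longrightarrow> is_inner_inverse (star a) (star x)"
  unfolding is_inner_inverse_def by (metis star_mult mult.assoc)

text \<open>If \<open>x\<close> is the Moore-Penrose inverse of \<open>a\<close>, then \<open>x*\<close> is that of \<open>a*\<close>.\<close>

lemma moore_penrose_star_imp:
  fixes a :: "'a::star_ring"
  assumes "moore_penrose_invertible a"
  shows "moore_penrose_invertible (star a)"
proof -
  obtain x where x: "a * x * a = a" "x * a * x = x" "star (a * x) = a * x" "star (x * a) = x * a"
    using assms unfolding moore_penrose_invertible_def by blast
  have "star a * star x * star a = star a" "star x * star a * star x = star x"
    using x(1,2) by (metis star_mult mult.assoc)+
  moreover have "star (star a * star x) = star a * star x"
    "star (star x * star a) = star x * star a"
    using x(3,4) by (metis star_mult)+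
  ultimately show ?thesis
    unfolding moore_penrose_invertible_def by blast
qed

lemma moore_penrose_star:
  fixes a :: "'a::star_ring"
  shows "moore_penrose_invertible (star a) \<longleftrightarrow> moore_penrose_invertible a"
  by (metis moore_penrose_star_imp star_star)

section \<open>A one-sided criterion for Moore-Penrose invertibility\<close>

text \<open>
  A factorization \<open>a = p a* a\<close> makes \<open>p*\<close> an inner inverse of \<open>a\<close> for which \<open>a p*\<close> is
  self-adjoint, and \<open>a = a a* q\<close> makes \<open>q*\<close> an inner inverse for which \<open>q* a\<close> is
  self-adjoint. The product \<open>q* a p*\<close> then satisfies all four Penrose equations.
\<close>

lemma moore_penrose_from_factors:
  fixes a p q :: "'a::star_ring"
  assumes p: "a = p * star a * a" and q: "a = a * star a * q"
  shows "moore_penrose_invertible a"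
proof -
  have sp: "star a = star a * a * star p"
    using p by (metis star_star star_mult mult.assoc)
  have sq: "star a = star q * a * star a"
    using q by (metis star_star star_mult mult.assoc)
  \<comment> \<open>\<open>a p* = p (a* a) p*\<close> is visibly self-adjoint, and similarly \<open>q* a = q* (a a*) q\<close>.\<close>
  have ap: "a * star p = p * star a"
    using p sp by (metis mult.assoc)
  have qa: "star q * a = star a * q"
    using q sq by (metis mult.assoc)
  have apa: "a * star p * a = a"
    using p ap by simp
  have aqa: "a * star q * a = a"
    using q qa by (metis mult.assoc)
  define x where "x = star q * a * star p"
  have ax: "a * x = a * star p"
    unfolding x_def using aqa by (metis mult.assoc)
  have xa: "x * a = star q * a"
    unfolding x_def using apa by (metis mult.assoc)
  have "a * x * a = a"
    using ax apa by simp
  moreover have "x * a * x = x"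
    unfolding xa using ax x_def by (metis mult.assoc)
  moreover have "star (a * x) = a * x"
    unfolding ax using ap by (simp add: star_mult star_star)
  moreover have "star (x * a) = x * a"
    unfolding xa using qa by (simp add: star_mult star_star)
  ultimately show ?thesis
    unfolding moore_penrose_invertible_def by blast
qed

lemma moore_penrose_iff_right_factor:
  fixes a :: "'a::star_ring"
  shows "moore_penrose_invertible a \<longleftrightarrow> (\<exists>y. a = a * star a * a * y)"
proof
  assume "moore_penrose_invertible a"
  then obtain x where x: "a * x * a = a" "star (a * x) = a * x" "star (x * a) = x * a"
    unfolding moore_penrose_invertible_def by blast
  have "a = a * star a * star x"
    using x(1,3) by (metis star_mult mult.assoc)
  moreover have "star a = star a * a * x"
    using x(1,2) by (metis star_mult mult.assoc)
  ultimately have "a = a * star a * a * (x * star x)"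
    by (metis mult.assoc)
  then show "\<exists>y. a = a * star a * a * y" ..
next
  assume "\<exists>y. a = a * star a * a * y"
  then obtain y where y: "a = a * star a * a * y" ..
  define s where "s = star a * a"
  have s_star: "star s = s"
    by (simp add: s_def star_mult star_star)
  have asy: "a = a * s * y"
    using y by (simp add: s_def mult.assoc)
  have ssy: "s = s * s * y"
    using asy by (metis s_def mult.assoc)
  have yss: "s = star y * s * s"
    using ssy s_star by (metis star_mult mult.assoc)
  \<comment> \<open>Both sides equal \<open>y* s s y\<close>, so \<open>y\<close> can be moved across \<open>s\<close> in \<open>a = a s y\<close>.\<close>
  have "s * y = star y * s"
    using ssy yss by (metis mult.assoc)
  then have "a = (a * star y) * star a * a"
    using asy by (metis s_def mult.assoc)
  moreover have "a = a * star a * (a * y)"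
    using y by (simp add: mult.assoc)
  ultimately show "moore_penrose_invertible a"
    by (rule moore_penrose_from_factors)
qed

section \<open>Invertibility of the associated elements\<close>

text \<open>Jacobson's lemma: if \<open>(1 + x y) z = 1\<close>, then \<open>1 - y z x\<close> is a right inverse of \<open>1 + y x\<close>.\<close>

lemma right_invertible_one_plus_swap_imp:
  fixes x y :: "'a::{ring,monoid_mult}"
  assumes "right_invertible (1 + x * y)"
  shows "right_invertible (1 + y * x)"
proof -
  obtain z where z: "(1 + x * y) * z = 1"
    using assms unfolding right_invertible_def by blast
  have "(1 + y * x) * (1 - y * z * x) = 1 + y * x - y * ((1 + x * y) * z) * x"
    by (simp add: algebra_simps)
  also have "\<dots> = 1"
    unfolding z by simp
  finally show ?thesis
    unfolding right_invertible_def by blast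
qed

lemma right_invertible_one_plus_swap:
  fixes x y :: "'a::{ring,monoid_mult}"
  shows "right_invertible (1 + x * y) \<longleftrightarrow> right_invertible (1 + y * x)"
  using right_invertible_one_plus_swap_imp by blast

lemma moore_penrose_iff_right_invertible_corner:
  fixes a a' :: "'a::star_ring"
  assumes "is_inner_inverse a a'"
  shows "moore_penrose_invertible a \<longleftrightarrow> right_invertible (a' * a * star a * a + 1 - a' * a)"
proof -
  define f where "f = a' * a"
  define s where "s = star a * a"
  have af: "a * f = a" and ff: "f * f = f" and sf: "s * f = s"
    using assms by (simp_all add: f_def s_def is_inner_inverse_def mult.assoc)
  have v: "a' * a * star a * a + 1 - a' * a = f * s + 1 - f"
    by (simp add: f_def s_def mult.assoc)
  have "(\<exists>y. a = a * s * y) \<longleftrightarrow> right_invertible (f * s + 1 - f)"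
  proof
    assume "\<exists>y. a = a * s * y"
    then obtain y where y: "a = a * s * y" ..
    have fsy: "f * s * y = f"
      using y by (metis f_def mult.assoc)
    \<comment> \<open>Invert blockwise: \<open>f y f\<close> on the corner of \<open>f\<close> and the identity on the complement.\<close>
    have "(f * s + 1 - f) * (f * y * f + 1 - f) =
        f * (s * f) * y * f + (f * s - f * (s * f)) + (f * y * f - (f * f) * y * f)
        + (1 - f) - (f - f * f)"
      by (simp add: algebra_simps)
    also have "\<dots> = 1"
      unfolding sf ff fsy by simp
    finally show "right_invertible (f * s + 1 - f)"
      unfolding right_invertible_def by blast
  next
    assume "right_invertible (f * s + 1 - f)"
    then obtain z where z: "(f * s + 1 - f) * z = 1"
      unfolding right_invertible_def by blast
    have "a = a * ((f * s + 1 - f) * z)"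
      by (simp add: z)
    also have "\<dots> = (a * f * s + a - a * f) * z"
      by (simp add: algebra_simps)
    also have "\<dots> = a * s * z"
      by (simp add: af)
    finally show "\<exists>y. a = a * s * y" ..
  qed
  then show ?thesis
    unfolding moore_penrose_iff_right_factor v by (simp add: s_def mult.assoc)
qed

lemma moore_penrose_iff_right_invertible:
  fixes a a' :: "'a::star_ring"
  assumes "is_inner_inverse a a'"
  shows "moore_penrose_invertible a \<longleftrightarrow> right_invertible (a * star a + 1 - a * a')"
    and "moore_penrose_invertible a \<longleftrightarrow> right_invertible (star a * a + 1 - a' * a)"
    and "moore_penrose_invertible a \<longleftrightarrow> right_invertible (a * star a * a * a' + 1 - a * a')"
    and "moore_penrose_invertible a \<longleftrightarrow> right_invertible (a' * a * star a * a + 1 - a' * a)"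
proof -
  have inner: "a * (a' * a) = a"
    using assms by (simp add: is_inner_inverse_def mult.assoc)
  have inner': "a * (a' * (a * t)) = a * t" for t
    using inner by (metis mult.assoc)
  show v: "moore_penrose_invertible a \<longleftrightarrow> right_invertible (a' * a * star a * a + 1 - a' * a)"
    using assms by (rule moore_penrose_iff_right_invertible_corner)
  show iv: "moore_penrose_invertible a \<longleftrightarrow> right_invertible (a * star a * a * a' + 1 - a * a')"
    using v right_invertible_one_plus_swap[of "a * star a * a - a" a']
    by (simp add: algebra_simps)
  show ii: "moore_penrose_invertible a \<longleftrightarrow> right_invertible (a * star a + 1 - a * a')"
    using iv right_invertible_one_plus_swap[of "a * star a - 1" "a * a'"]
    by (simp add: algebra_simps inner')
  show "moore_penrose_invertible a \<longleftrightarrow> right_invertible (star a * a + 1 - a' * a)"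
    using ii right_invertible_one_plus_swap[of a "star a - a'"]
    by (simp add: algebra_simps)
qed

section \<open>The nine equivalent conditions\<close>

text \<open>
  Passing from \<open>a, a'\<close> to \<open>a*, a'*\<close> interchanges the roles of \<open>a a'\<close> and \<open>a' a\<close>; hence each
  condition on left inverses comes from the condition on right inverses for the opposite idempotent.
\<close>

theorem theorem5p1:
  fixes a a' :: "'a::star_ring"
  assumes "regular_element a"
    and "is_inner_inverse a a'"
  shows
    "(moore_penrose_invertible a \<longleftrightarrow> right_invertible (a * star a + 1 - a * a')) \<and>
     (moore_penrose_invertible a \<longleftrightarrow> right_invertible (star a * a + 1 - a' * a)) \<and>
     (moore_penrose_invertible a \<longleftrightarrow> right_invertible (a * star a * a * a' + 1 - a * a')) \<and>
     (moore_penrose_invertible a \<longleftrightarrow> right_invertible (a' * a * star a * a + 1 - a' * a)) \<and>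
     (moore_penrose_invertible a \<longleftrightarrow> left_invertible (a * star a + 1 - a * a')) \<and>
     (moore_penrose_invertible a \<longleftrightarrow> left_invertible (star a * a + 1 - a' * a)) \<and>
     (moore_penrose_invertible a \<longleftrightarrow> left_invertible (a * star a * a * a' + 1 - a * a')) \<and>
     (moore_penrose_invertible a \<longleftrightarrow> left_invertible (a' * a * star a * a + 1 - a' * a))"
proof -
  note right = moore_penrose_iff_right_invertible[OF assms(2)]
  note right_star = moore_penrose_iff_right_invertible
    [OF is_inner_inverse_star[OF assms(2)], unfolded moore_penrose_star star_star]
  have "moore_penrose_invertible a \<longleftrightarrow> left_invertible (a * star a + 1 - a * a')"
    unfolding left_invertible_iff_star right_star(2)
    by (simp add: star_add star_diff star_mult star_one star_star)
  moreover have "moore_penrose_invertible a \<longleftrightarrow> left_invertible (star a * a + 1 - a' * a)"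
    unfolding left_invertible_iff_star right_star(1)
    by (simp add: star_add star_diff star_mult star_one star_star)
  moreover have
    "moore_penrose_invertible a \<longleftrightarrow> left_invertible (a * star a * a * a' + 1 - a * a')"
    unfolding left_invertible_iff_star right_star(4)
    by (simp add: star_add star_diff star_mult star_one star_star mult.assoc)
  moreover have
    "moore_penrose_invertible a \<longleftrightarrow> left_invertible (a' * a * star a * a + 1 - a' * a)"
    unfolding left_invertible_iff_star right_star(3)
    by (simp add: star_add star_diff star_mult star_one star_star mult.assoc)
  ultimately show ?thesis
    using right by blast
qed

end
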